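(* Let $F_2^{\otimes k}=\underbrace{F_2\otimes\cdots\otimes F_2}_{k\text{ terms}}$. If $q$ is an odd prime and $k\in\{1,2,3\}$, then $F_2^{\otimes k}\otimes F_q$ is principally non-singular upon permutation, i.e., there is a permutation of its columns such that all principal minors of the permuted matrix are non-zero. In particular, for $k=1$ the identity permutation suffices, i.e., all principal minors of $F_2\otimes F_q$ are non-zero.
   Context: $\mathbb Z_n=\{0,1,\ldots,n-1\}$ is the cyclic group of order $n$ and $\zeta_n=e^{2\pi i/n}$. The Fourier matrix $F_n$ is the $n\times n$ complex matrix with rows and columns indexed by $\mathbb Z_n$ and $(j,k)$-th entry $\zeta_n^{jk}$ (no normalizing factor). In particular $F_2=\begin{pmatrix}1&1\\1&-1\end{pmatrix}$. For $A\in\mathbb C^{m\times m}$ and $B\in\mathbb C^{n\times n}$, the Kronecker product $A\otimes B$ is the $mn\times mn$ block matrix whose $(i,j)$-th block is $A[i,j]B$. Equivalently, its rows and columns are indexed by pairs $(i,i')$ with $i\in\mathbb Z_m$, $i'\in\mathbb Z_n$, and its entry in row $(i,i')$ and column $(j,j')$ is $A[i,j]B[i',j']$. In particular $F_2^{\otimes k}\otimes F_q$ is the Fourier matrix on $\mathbb Z_2^k\times\mathbb Z_q$. For a square matrix $A$ whose rows and columns are indexed by the same finite set, a principal minor is the determinant of the submatrix $A[\mathcal I,\mathcal I]$ obtained by keeping the rows and the columns with indices in the same subset $\mathcal I$ of the index set. A matrix is principally non-singular if all its principal minors are non-zero. It is principally non-singular upon permutation if there is a column permutation (a permutation matrix $P$)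 such that all principal minors of the permuted matrix $AP$ are non-zero. *)

theory Defs
  imports
    "Jordan_Normal_Form.Determinant"
    "Jordan_Normal_Form.DL_Submatrix"
    "HOL-Combinatorics.Permutations"
    "HOL-Computational_Algebra.Primes"
    Complex_Main
begin

definition fourier_mat :: "nat \<Rightarrow> complex mat" where
  "fourier_mat n =
     mat n n (\<lambda>(j, k). exp (2 * of_real pi * \<i> / of_nat n) ^ (j * k))"

text \<open>
  The pair \<open>(i, i')\<close> of a row index of \<open>A\<close> and a row index of \<open>B\<close> is encoded as
  \<open>i * dim_row B + i'\<close>, and likewise for columns; this is the block matrix with blocks
  \<open>A $$ (i, j) \<cdot>\<^sub>m B\<close>.
\<close>

definition kronecker_mat :: "'a :: times mat \<Rightarrow> 'a mat \<Rightarrow> 'a mat" where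
  "kronecker_mat A B =
     mat (dim_row A * dim_row B) (dim_col A * dim_col B)
       (\<lambda>(r, c). A $$ (r div dim_row B, c div dim_col B) *
                 B $$ (r mod dim_row B, c mod dim_col B))"

primrec kronecker_power :: "'a :: semiring_1 mat \<Rightarrow> nat \<Rightarrow> 'a mat" where
  "kronecker_power A 0 = 1\<^sub>m 1"
| "kronecker_power A (Suc k) = kronecker_mat A (kronecker_power A k)"

definition permutation_mat :: "nat \<Rightarrow> (nat \<Rightarrow> nat) \<Rightarrow> 'a :: zero_neq_one mat" where
  "permutation_mat n p = mat n n (\<lambda>(i, j). if i = p j then 1 else 0)"

text \<open>The empty index set is harmless below: its minor is the empty determinant 1.\<close>

definition principally_nonsingular :: "'a :: comm_ring_1 mat \<Rightarrow> bool" where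
  "principally_nonsingular A \<longleftrightarrow>
     square_mat A \<and> (\<forall>I \<subseteq> {..<dim_row A}. det (submatrix A I I) \<noteq> 0)"

definition principally_nonsingular_upon_permutation :: "'a :: comm_ring_1 mat \<Rightarrow> bool" where
  "principally_nonsingular_upon_permutation A \<longleftrightarrow>
     (\<exists>p. p permutes {..<dim_col A} \<and>
          principally_nonsingular (A * permutation_mat (dim_col A) p))"

lemma kronecker_mat_index:
  assumes "i < dim_row A" "i' < dim_row B" "j < dim_col A" "j' < dim_col B"
  shows "kronecker_mat A B $$ (i * dim_row B + i', j * dim_col B + j') =
           A $$ (i, j) * B $$ (i', j')"
proof -
  have less: "a * n + b < m * n" if "a < m" "b < n" for a b m n :: nat
  proof -
    have "a * n + b < Suc a * n" using that by simp
    also have "\<dots> \<le> m * n" using that by (intro mult_right_mono) auto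
    finally show ?thesis .
  qed
  show ?thesis
    using assms less[OF assms(1,2)] less[OF assms(3,4)]
    by (simp add: kronecker_mat_def)
qed

lemma kronecker_power_one: "kronecker_power A 1 = A"
  by (rule eq_matI) (auto simp: kronecker_mat_def)

lemma fourier_mat_2: "fourier_mat 2 = mat_of_rows_list 2 [[1, 1], [1, -1]]"
  by (rule eq_matI)
    (auto simp: fourier_mat_def mat_of_rows_list_def less_Suc_eq numeral_2_eq_2)

lemma mult_permutation_mat_index:
  fixes A :: "'a :: comm_ring_1 mat"
  assumes "p permutes {..<dim_col A}" "i < dim_row A" "j < dim_col A"
  shows "(A * permutation_mat (dim_col A) p) $$ (i, j) = A $$ (i, p j)"
proof -
  have "p j < dim_col A" using permutes_in_image[OF assms(1)] assms(3) by blast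
  then show ?thesis using assms(2,3)
    by (simp add: permutation_mat_def scalar_prod_def if_distrib sum.delta cong: if_cong)
qed

end

theory Submission
  imports Defs "Jordan_Normal_Form.Char_Poly"
begin

text \<open>
  Let \<open>\<zeta>\<close> be a primitive \<open>q\<close>-th root of unity and \<open>\<lambda> = 1 - \<zeta>\<close>. A vanishing principal minor of
  \<open>H \<otimes> F\<^sub>q\<close> yields a nonzero kernel vector \<open>x\<close> with entries in \<open>\<int>[\<zeta>]\<close>. If the principal minors of the
  integer matrix \<open>H\<close> are prime to \<open>q\<close>, comparing Taylor coefficients at 1 of the polynomials
  \<open>\<Sum>b. x(j,b) X\<^sup>b\<close> shows that every entry of \<open>x\<close> is divisible by \<open>\<lambda>\<close>; as \<open>x/\<lambda>\<close> is again a kernel vector,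
  \<open>x\<close> is divisible by all powers of \<open>\<lambda>\<close>, so \<open>x = 0\<close>. It remains to permute the columns of the Sylvester
  matrices \<open>H\<close> of order 2, 4 and 8 so that all principal minors are, up to sign, powers of 2.
\<close>

section \<open>Linear algebra modulo an ideal\<close>

locale unital_subring =
  fixes S :: "'a :: idom set"
  assumes zero_mem [simp]: "0 \<in> S"
    and one_mem [simp]: "1 \<in> S"
    and add_mem: "x \<in> S \<Longrightarrow> y \<in> S \<Longrightarrow> x + y \<in> S"
    and uminus_mem: "x \<in> S \<Longrightarrow> - x \<in> S"
    and mult_mem: "x \<in> S \<Longrightarrow> y \<in> S \<Longrightarrow> x * y \<in> S"
begin

lemma diff_mem: "x \<in> S \<Longrightarrow> y \<in> S \<Longrightarrow> x - y \<in> S"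
  using add_mem[of x "- y"] uminus_mem[of y] by simp

lemma sum_mem: "(\<And>i. i \<in> A \<Longrightarrow> f i \<in> S) \<Longrightarrow> sum f A \<in> S"
  by (induction A rule: infinite_finite_induct) (auto intro: add_mem)

lemma power_mem: "x \<in> S \<Longrightarrow> x ^ n \<in> S"
  by (induction n) (auto intro: mult_mem)

lemma of_nat_mem: "of_nat n \<in> S"
  by (induction n) (auto intro: add_mem)

lemma of_int_mem: "of_int n \<in> S"
  by (cases n rule: int_diff_cases) (auto intro: diff_mem of_nat_mem)

lemma poly_mem: "(\<And>n. coeff p n \<in> S) \<Longrightarrow> x \<in> S \<Longrightarrow> poly p x \<in> S"
  by (simp add: poly_altdef sum_mem mult_mem power_mem)

lemma synthetic_div_mem:
  assumes "\<And>n. coeff p n \<in> S" "c \<in> S"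
  shows "coeff (synthetic_div p c) n \<in> S"
  using assms(1)
proof (induction p arbitrary: n)
  case 0
  then show ?case by simp
next
  case (pCons a p)
  have "coeff p n \<in> S" for n
    using pCons.prems[of "Suc n"] by simp
  then show ?case
    using pCons.IH assms(2) by (auto simp: coeff_pCons poly_mem split: nat.split)
qed

text \<open>Fraction-free Gaussian elimination: cross-multiplying by a pivot keeps all coefficients
  in \<open>S\<close>, so a nontrivial solution over the ambient domain can be traded for one with
  entries in \<open>S\<close>.\<close>

lemma linear_system_solution_mem:
  assumes "finite C"
    and "\<And>r c. r \<in> R \<Longrightarrow> c \<in> C \<Longrightarrow> A r c \<in> S"
    and "\<And>r. r \<in> R \<Longrightarrow> (\<Sum>c\<in>C. A r c * v c) = 0"
    and "\<exists>c\<in>C. v c \<noteq> 0"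
  shows "\<exists>w. (\<forall>c\<in>C. w c \<in> S) \<and> (\<exists>c\<in>C. w c \<noteq> 0) \<and> (\<forall>r\<in>R. (\<Sum>c\<in>C. A r c * w c) = 0)"
  using assms
proof (induction C arbitrary: A rule: finite_induct)
  case empty
  then show ?case by simp
next
  case (insert d C)
  show ?case
  proof (cases "\<forall>r\<in>R. A r d = 0")
    case True
    \<comment> \<open>A zero column is annihilated by its own unit vector.\<close>
    then show ?thesis
      by (intro exI[of _ "\<lambda>c. if c = d then 1 else 0"])
        (auto intro!: sum.neutral simp: insert.hyps)
  next
    case False
    then obtain s where s: "s \<in> R" "A s d \<noteq> 0" by blast
    define B where "B r c = A s d * A r c - A r d * A s c" for r c
    have eq: "A r d * v d + (\<Sum>c\<in>C. A r c * v c) = 0" if "r \<in> R" for r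
      using insert.prems(2)[OF that] insert.hyps by simp
    have B_sum: "(\<Sum>c\<in>C. B r c * w c) =
        A s d * (\<Sum>c\<in>C. A r c * w c) - A r d * (\<Sum>c\<in>C. A s c * w c)" for r w
      by (simp add: B_def sum_subtractf sum_distrib_left algebra_simps)
    have 1: "B r c \<in> S" if "r \<in> R" "c \<in> C" for r c
      using that s insert.prems(1) by (auto simp: B_def intro!: diff_mem mult_mem)
    have 2: "(\<Sum>c\<in>C. B r c * v c) = 0" if "r \<in> R" for r
    proof -
      have "(\<Sum>c\<in>C. A r c * v c) = - (A r d * v d)" "(\<Sum>c\<in>C. A s c * v c) = - (A s d * v d)"
        using eq[OF that] eq[OF s(1)] by (simp_all add: eq_neg_iff_add_eq_0 add.commute)
      then show ?thesis by (simp add: B_sum)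
    qed
    have 3: "\<exists>c\<in>C. v c \<noteq> 0"
    proof (rule ccontr)
      assume "\<not> (\<exists>c\<in>C. v c \<noteq> 0)"
      then have "v d = 0" using eq[OF s(1)] s(2) by simp
      then show False using insert.prems(3) \<open>\<not> (\<exists>c\<in>C. v c \<noteq> 0)\<close> by auto
    qed
    obtain w where w: "\<forall>c\<in>C. w c \<in> S" "\<exists>c\<in>C. w c \<noteq> 0" "\<forall>r\<in>R. (\<Sum>c\<in>C. B r c * w c) = 0"
      using insert.IH[of B, OF 1 2 3] by blast
    \<comment> \<open>Back substitution, scaled by the pivot \<open>A s d\<close> so that no
      division occurs.\<close>
    define u where "u c = (if c = d then - (\<Sum>c\<in>C. A s c * w c) else A s d * w c)" for c
    have u_sum: "(\<Sum>c\<in>C. A r c * u c) = A s d * (\<Sum>c\<in>C. A r c * w c)" for r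
      unfolding sum_distrib_left using insert.hyps by (intro sum.cong) (auto simp: u_def)
    have "u c \<in> S" if "c \<in> insert d C" for c
      using that w(1) insert.prems(1) s(1)
      by (auto simp: u_def intro!: uminus_mem sum_mem mult_mem)
    moreover have "\<exists>c\<in>insert d C. u c \<noteq> 0"
      using w(2) s(2) insert.hyps by (auto simp: u_def)
    moreover have "(\<Sum>c\<in>insert d C. A r c * u c) = 0" if "r \<in> R" for r
      using w(3) that insert.hyps B_sum[of r w] u_sum[of r] by (simp add: u_def)
    ultimately show ?thesis by blast
  qed
qed

end

text \<open>In the application \<open>S\<close> is the ring generated by a root of unity
  \<open>z\<close> and \<open>P\<close> its ideal generated by \<open>1 - z\<close>. Primality
  enters through the integer \<open>q\<close> in \<open>P\<close>: integers prime to
  \<open>q\<close> can be cancelled modulo \<open>P\<close>.\<close>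

locale subring_prime_ideal = unital_subring S for S :: "'a :: idom set" +
  fixes P :: "'a set" and q :: nat
  assumes P_sub: "P \<subseteq> S"
    and zero_P [simp]: "0 \<in> P"
    and add_P: "x \<in> P \<Longrightarrow> y \<in> P \<Longrightarrow> x + y \<in> P"
    and mult_P: "x \<in> S \<Longrightarrow> y \<in> P \<Longrightarrow> x * y \<in> P"
    and q_P: "of_nat q \<in> P"
    and prime_q: "prime q"
begin

lemma uminus_P: "x \<in> P \<Longrightarrow> - x \<in> P"
  using mult_P[of "- 1" x] uminus_mem[of 1] by simp

lemma diff_P: "x \<in> P \<Longrightarrow> y \<in> P \<Longrightarrow> x - y \<in> P"
  using add_P[of x "- y"] uminus_P[of y] by simp

lemma sum_P: "(\<And>i. i \<in> A \<Longrightarrow> f i \<in> P) \<Longrightarrow> sum f A \<in> P"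
  by (induction A rule: infinite_finite_induct) (auto intro: add_P)

lemma of_int_cancel_P:
  assumes "\<not> int q dvd n" "x \<in> S" "of_int n * x \<in> P"
  shows "x \<in> P"
proof -
  have "coprime (int q) n"
    using prime_q assms(1) by (intro prime_imp_coprime) auto
  then obtain u v where "u * int q + v * n = 1"
    using bezout_int[of "int q" n] by auto
  then have "of_int (u * int q + v * n) = (1 :: 'a)" by simp
  then have eq: "(of_int u * of_nat q + of_int v * of_int n :: 'a) = 1" by simp
  have "x = (of_int u * of_nat q + of_int v * of_int n) * x" unfolding eq by simp
  also have "\<dots> = (of_int u * x) * of_nat q + of_int v * (of_int n * x)"
    by (simp add: algebra_simps)
  also have "\<dots> \<in> P"
    by (rule add_P[OF mult_P[OF mult_mem[OF of_int_mem assms(2)] q_P] mult_P[OF of_int_mem assms(3)]])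
  finally show ?thesis .
qed

text \<open>The product of the factors X - r is monic and congruent to X^|R| modulo
  \<open>P\<close>, and it divides \<open>g\<close> over \<open>S\<close>. The induction peels off
  one root at a time; synthetic division by a monic linear factor keeps the coefficients in
  \<open>S\<close>.\<close>

lemma coeff_P_of_roots_P:
  assumes "finite R" "R \<subseteq> P" "\<And>n. coeff g n \<in> S" "\<And>r. r \<in> R \<Longrightarrow> poly g r = 0"
    and "n < card R"
  shows "coeff g n \<in> P"
  using assms
proof (induction R arbitrary: g n rule: finite_induct)
  case empty
  then show ?case by simp
next
  case (insert r R)
  define h where "h = synthetic_div g r"
  have r: "r \<in> P" "r \<in> S" using insert.prems(1) P_sub by auto
  have h_S: "coeff h n \<in> S" for n
    unfolding h_def by (rule synthetic_div_mem) (use insert.prems(2) r in auto)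
  have g: "g = [:- r, 1:] * h"
    using synthetic_div_correct'[of r g] insert.prems(3)[of r] by (simp add: h_def)
  have "poly h s = 0" if "s \<in> R" for s
    using insert.prems(3)[of s] that insert.hyps(2) g by auto
  then have IH: "coeff h n \<in> P" if "n < card R" for n
    using insert.IH[OF _ h_S _ that] insert.prems(1) by auto
  have "r * coeff h n \<in> P" for n
    using mult_P[OF h_S r(1)] by (simp add: mult.commute)
  \<comment> \<open>Multiplication by X shifts coefficients by one place, which matches the bound
    for \<open>h\<close> being one smaller.\<close>
  moreover have "coeff (pCons 0 h) n \<in> P"
    using IH insert.prems(4) insert.hyps by (cases n) (auto simp: coeff_pCons)
  ultimately show ?case
    unfolding g by (auto intro!: diff_P)
qed

text \<open>The functions \<open>b \<mapsto> b choose n\<close> with \<open>n < card B\<close> span, over the integers, the function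
  \<open>b \<mapsto> \<Prod>b'\<in>B - {b\<^sub>0}. (b - b')\<close>, which isolates the value at \<open>b\<^sub>0\<close>.\<close>

lemma mem_P_of_binomial_moments_P:
  assumes "B \<subseteq> {..<q}" "\<And>b. b \<in> B \<Longrightarrow> x b \<in> S"
    and mom: "\<And>n. n < card B \<Longrightarrow> (\<Sum>b\<in>B. x b * of_nat (b choose n)) \<in> P"
    and "c \<in> B"
  shows "x c \<in> P"
proof -
  have fin: "finite B" using assms(1) finite_subset by blast
  \<comment> \<open>The index \<open>n\<close> has to vary: by \<open>absorb\<close>, removing a
    factor b - d from the product either keeps the lower binomial index or raises it by one, so
    \<open>n + card D\<close> never grows.\<close>
  have gen: "(\<Sum>b\<in>B. x b * (of_nat (b choose n) * (\<Prod>d\<in>D. of_nat b - of_nat d))) \<in> P"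
    if "finite D" "n + card D < card B" for D n
    using that
  proof (induction D arbitrary: n rule: finite_induct)
    case empty
    then show ?case using mom[of n] by simp
  next
    case (insert d D)
    have absorb: "of_nat (b choose n) * (of_nat b - of_nat d :: 'a) =
        of_nat (Suc n) * of_nat (b choose Suc n) + (of_nat n - of_nat d) * of_nat (b choose n)" for b
    proof -
      have "of_nat (Suc n) * of_nat (b choose Suc n) = (of_nat b - of_nat n) * (of_nat (b choose n) :: 'a)"
      proof (cases "n \<le> b")
        case True
        have "Suc n * (b choose Suc n) = (b - n) * (b choose n)"
          by (simp only: binomial_absorption binomial_absorb_comp)
        then have "(of_nat (Suc n * (b choose Suc n)) :: 'a) = of_nat ((b - n) * (b choose n))" by (rule arg_cong)
        then show ?thesis unfolding of_nat_mult using True by (simp add: of_nat_diff)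
      next
        case False
        then show ?thesis by (simp add: binomial_eq_0)
      qed
      then show ?thesis by (simp add: algebra_simps)
    qed
    have "(\<Sum>b\<in>B. x b * (of_nat (b choose n) * (\<Prod>d\<in>insert d D. of_nat b - of_nat d))) =
      (\<Sum>b\<in>B. x b * ((of_nat (b choose n) * (of_nat b - of_nat d)) * (\<Prod>d\<in>D. of_nat b - of_nat d)))"
      using insert.hyps by (simp add: mult.assoc)
    also have "\<dots> =
      of_nat (Suc n) * (\<Sum>b\<in>B. x b * (of_nat (b choose Suc n) * (\<Prod>d\<in>D. of_nat b - of_nat d))) +
      (of_nat n - of_nat d) * (\<Sum>b\<in>B. x b * (of_nat (b choose n) * (\<Prod>d\<in>D. of_nat b - of_nat d)))"
      unfolding absorb sum_distrib_left sum.distrib[symmetric]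
      by (intro sum.cong) (auto simp: algebra_simps)
    also have "\<dots> \<in> P"
      using insert by (intro add_P mult_P diff_mem of_nat_mem) auto
    finally show ?case .
  qed
  \<comment> \<open>The value at \<open>c\<close> of the isolating product. The points of
    \<open>B\<close> are distinct and below \<open>q\<close>, so no factor is divisible by
    \<open>q\<close>.\<close>
  define m where "m = (\<Prod>d\<in>B - {c}. int c - int d)"
  have "(\<Sum>b\<in>B. x b * (of_nat (b choose 0) * (\<Prod>d\<in>B - {c}. of_nat b - of_nat d))) \<in> P"
    using fin \<open>c \<in> B\<close> card_Diff1_less[of B c] by (intro gen) auto
  also have "(\<Sum>b\<in>B. x b * (of_nat (b choose 0) * (\<Prod>d\<in>B - {c}. of_nat b - of_nat d))) =
      (\<Sum>b\<in>B. if b = c then of_int m * x c else 0)"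
  proof (intro sum.cong refl, goal_cases)
    case (1 b)
    show ?case
    proof (cases "b = c")
      case True
      then show ?thesis by (simp add: m_def mult.commute)
    next
      case False
      then have "(\<Prod>d\<in>B - {c}. of_nat b - of_nat d :: 'a) = 0"
        using 1 fin by (intro prod_zero) auto
      then show ?thesis using False by simp
    qed
  qed
  also have "\<dots> = of_int m * x c" using fin \<open>c \<in> B\<close> by simp
  finally have "of_int m * x c \<in> P" .
  moreover have "\<not> int q dvd m"
  proof
    assume "int q dvd m"
    then obtain d where d: "d \<in> B - {c}" "int q dvd int c - int d"
      using prime_q fin by (auto simp: m_def prime_dvd_prod_iff)
    moreover have "int c - int d \<noteq> 0" "\<bar>int c - int d\<bar> < int q"
      using d assms(1) \<open>c \<in> B\<close> by (auto simp: subset_iff abs_if)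
    ultimately show False
      using zdvd_imp_le[of "int q" "\<bar>int c - int d\<bar>"] by auto
  qed
  ultimately show ?thesis
    using of_int_cancel_P assms(2) \<open>c \<in> B\<close> by blast
qed

text \<open>Injectivity modulo \<open>P\<close> of every principal submatrix replaces the condition
  that the principal minors be prime to \<open>q\<close>; in this form it needs no determinants and
  applies directly to vectors of Taylor coefficients.\<close>

definition principally_nonsingular_mod :: "nat \<Rightarrow> (nat \<Rightarrow> nat \<Rightarrow> int) \<Rightarrow> bool" where
  "principally_nonsingular_mod m H \<longleftrightarrow>
    (\<forall>T\<subseteq>{..<m}. \<forall>y. (\<forall>j\<in>T. y j \<in> S) \<longrightarrow>
      (\<forall>i\<in>T. (\<Sum>j\<in>T. of_int (H i j) * y j) \<in> P) \<longrightarrow> (\<forall>j\<in>T. y j \<in> P))"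

lemma principally_nonsingular_modD:
  assumes "principally_nonsingular_mod m H" "T \<subseteq> {..<m}" "\<And>j. j \<in> T \<Longrightarrow> y j \<in> S"
    and "\<And>i. i \<in> T \<Longrightarrow> (\<Sum>j\<in>T. of_int (H i j) * y j) \<in> P" "j \<in> T"
  shows "y j \<in> P"
  using assms unfolding principally_nonsingular_mod_def by blast

lemma principally_nonsingular_mod_0: "principally_nonsingular_mod 0 H"
  by (simp add: principally_nonsingular_mod_def)

text \<open>A principal minor containing the index 0 is the pivot times a principal minor of the
  Schur complement, here multiplied by the pivot to keep the entries integral.\<close>

lemma principally_nonsingular_mod_Suc:
  assumes pivot: "\<not> int q dvd H 0 0"
    and rest: "principally_nonsingular_mod m (\<lambda>i j. H (Suc i) (Suc j))"
    and schur: "principally_nonsingular_mod m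
      (\<lambda>i j. H 0 0 * H (Suc i) (Suc j) - H (Suc i) 0 * H 0 (Suc j))"
  shows "principally_nonsingular_mod (Suc m) H"
  unfolding principally_nonsingular_mod_def
proof (intro allI impI)
  fix T and y :: "nat \<Rightarrow> 'a"
  assume T: "T \<subseteq> {..<Suc m}" and yS: "\<forall>j\<in>T. y j \<in> S"
    and yP: "\<forall>i\<in>T. (\<Sum>j\<in>T. of_int (H i j) * y j) \<in> P"
  \<comment> \<open>Both smaller matrices are indexed from 0, hence the shift by one.\<close>
  define U where "U = {i. Suc i \<in> T}"
  have U: "U \<subseteq> {..<m}" "finite U"
    using T by (auto simp: U_def intro: finite_subset[of _ "{..<m}"])
  have T_eq: "T = (if 0 \<in> T then insert 0 (Suc ` U) else Suc ` U)"
    unfolding U_def image_def by (auto simp: gr0_conv_Suc) (metis not0_implies_Suc)+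
  have sum_SucU: "sum f (Suc ` U) = (\<Sum>j\<in>U. f (Suc j))" for f :: "nat \<Rightarrow> 'a"
    by (simp add: sum.reindex)
  show "\<forall>j\<in>T. y j \<in> P"
  proof (cases "0 \<in> T")
    case False
    then have T': "T = Suc ` U" using T_eq by simp
    have "y (Suc j) \<in> P" if "j \<in> U" for j
      by (rule principally_nonsingular_modD[OF rest U(1) _ _ that, of "\<lambda>j. y (Suc j)"])
        (use yS yP in \<open>auto simp: T' sum_SucU\<close>)
    then show ?thesis by (auto simp: T')
  next
    case True
    then have T': "T = insert 0 (Suc ` U)" using T_eq by simp
    have sum_T: "sum f T = f 0 + (\<Sum>j\<in>U. f (Suc j))" for f :: "nat \<Rightarrow> 'a"
      using U by (simp add: T' sum_SucU)
    have row: "of_int (H i 0) * y 0 + (\<Sum>j\<in>U. of_int (H i (Suc j)) * y (Suc j)) \<in> P" if "i \<in> T" for i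
      using yP that by (simp add: sum_T)
    have tail: "y (Suc j) \<in> P" if "j \<in> U" for j
    proof (rule principally_nonsingular_modD[OF schur U(1) _ _ that, of "\<lambda>j. y (Suc j)"])
      fix i assume "i \<in> U"
      then have i: "Suc i \<in> T" by (simp add: U_def)
      \<comment> \<open>The pivot times row \<open>Suc i\<close> minus a multiple of row 0: the
        terms with \<open>y 0\<close> cancel and a row of the scaled Schur complement
        remains.\<close>
      have "of_int (H 0 0) * (of_int (H (Suc i) 0) * y 0 + (\<Sum>j\<in>U. of_int (H (Suc i) (Suc j)) * y (Suc j)))
        - of_int (H (Suc i) 0) * (of_int (H 0 0) * y 0 + (\<Sum>j\<in>U. of_int (H 0 (Suc j)) * y (Suc j))) \<in> P"
        using row[OF i] row[OF True] by (intro diff_P mult_P of_int_mem)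
      also have "of_int (H 0 0) * (of_int (H (Suc i) 0) * y 0 + (\<Sum>j\<in>U. of_int (H (Suc i) (Suc j)) * y (Suc j)))
        - of_int (H (Suc i) 0) * (of_int (H 0 0) * y 0 + (\<Sum>j\<in>U. of_int (H 0 (Suc j)) * y (Suc j))) =
        (\<Sum>j\<in>U. of_int (H 0 0 * H (Suc i) (Suc j) - H (Suc i) 0 * H 0 (Suc j)) * y (Suc j))"
        by (simp add: algebra_simps sum_subtractf sum_distrib_left)
      finally show "\<dots> \<in> P" .
    qed (use yS in \<open>simp add: U_def\<close>)
    have "(\<Sum>j\<in>U. of_int (H 0 (Suc j)) * y (Suc j)) \<in> P"
      using tail by (intro sum_P mult_P of_int_mem)
    then have "of_int (H 0 0) * y 0 \<in> P"
      using diff_P[OF row[OF True]] by fastforce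
    then have "y 0 \<in> P"
      using of_int_cancel_P[OF pivot] yS True by blast
    then show ?thesis using tail by (auto simp: T')
  qed
qed

lemma principally_nonsingular_mod_cong:
  assumes "\<And>i j. i < m \<Longrightarrow> j < m \<Longrightarrow> H i j = H' i j"
  shows "principally_nonsingular_mod m H \<longleftrightarrow> principally_nonsingular_mod m H'"
proof -
  have "(\<Sum>j\<in>T. of_int (H i j) * y j) = (\<Sum>j\<in>T. of_int (H' i j) * y j)"
    if "T \<subseteq> {..<m}" "i \<in> T" for T i and y :: "nat \<Rightarrow> 'a"
    using that assms by (intro sum.cong refl arg_cong2[where f = "(*)"] arg_cong[where f = of_int]) blast+
  then show ?thesis unfolding principally_nonsingular_mod_def by simp
qed

text \<open>With \<open>f\<^sub>j(X) = \<Sum>b. x(j,b) X\<^sup>b\<close>, the hypothesis says that \<open>\<Sum>j. H(i,j) f\<^sub>j\<close> vanishes at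
  the \<open>n\<^sub>i\<close> points \<open>z\<^sup>a\<close>, which all coincide with 1 modulo \<open>P\<close>. Hence its first \<open>n\<^sub>i\<close> Taylor
  coefficients at 1 lie in \<open>P\<close>; by induction on the order, so do those of \<open>f\<^sub>i\<close>.\<close>

lemma kernel_mem_P:
  assumes H: "principally_nonsingular_mod m H"
    and z: "z \<in> S" "1 - z \<in> P" "inj_on (\<lambda>a. z ^ a) {..<q}"
    and B: "\<And>j. j < m \<Longrightarrow> B j \<subseteq> {..<q}"
    and xS: "\<And>j b. j < m \<Longrightarrow> b \<in> B j \<Longrightarrow> x j b \<in> S"
    and ker: "\<And>i a. i < m \<Longrightarrow> a \<in> B i \<Longrightarrow>
      (\<Sum>j<m. \<Sum>b\<in>B j. of_int (H i j) * z ^ (a * b) * x j b) = 0"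
    and "j < m" "b \<in> B j"
  shows "x j b \<in> P"
proof -
  have fin: "finite (B j)" if "j < m" for j
    using B[OF that] finite_subset by blast
  \<comment> \<open>The \<open>n\<close>-th Taylor coefficient at 1 of the polynomial of block
    \<open>j\<close>.\<close>
  define F where "F j n = (\<Sum>b\<in>B j. x j b * of_nat (b choose n))" for j n
  have FS: "F j n \<in> S" if "j < m" for j n
    using xS[OF that] by (auto simp: F_def intro!: sum_mem mult_mem of_nat_mem)
  have z1: "z ^ a - 1 \<in> P" for a
  proof -
    have "z ^ a - 1 = - (\<Sum>i<a. z ^ i) * (1 - z)"
      using power_diff_1_eq[of z a] by (cases "z = 1") (simp_all add: algebra_simps)
    also have "\<dots> \<in> P"
      using z by (intro mult_P uminus_mem sum_mem power_mem)
    finally show ?thesis .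
  qed
  have taylor: "(\<Sum>j<m. of_int (H i j) * F j n) \<in> P" if i: "i < m" and n: "n < card (B i)" for i n
  proof -
    \<comment> \<open>The combined polynomial of row \<open>i\<close> with X replaced by 1 + X: its
      coefficients are the Taylor coefficients at 1, and its roots \<open>z ^ a - 1\<close> lie in
      \<open>P\<close>.\<close>
    define g where "g = (\<Sum>j<m. \<Sum>b\<in>B j. smult (of_int (H i j) * x j b) ([:1, 1:] ^ b))"
    have coeff_pow: "coeff ([:1, 1 :: 'a:] ^ b) n = of_nat (b choose n)" for b n
      by (cases "n \<le> b")
        (simp_all add: coeff_linear_poly_power binomial_eq_0 coeff_eq_0 degree_linear_power)
    have coeff_g: "coeff g n = (\<Sum>j<m. of_int (H i j) * F j n)" for n
      by (simp add: g_def coeff_sum coeff_pow F_def sum_distrib_left mult.assoc)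
    have "coeff g n \<in> P"
    proof (rule coeff_P_of_roots_P)
      show "finite ((\<lambda>a. z ^ a - 1) ` B i)" using fin[OF i] by simp
      show "(\<lambda>a. z ^ a - 1) ` B i \<subseteq> P" using z1 by auto
      show "coeff g n \<in> S" for n
        unfolding coeff_g using FS by (intro sum_mem mult_mem of_int_mem) auto
      have "inj_on (\<lambda>a. z ^ a) (B i)" using inj_on_subset[OF z(3) B[OF i]] .
      then have "inj_on (\<lambda>a. z ^ a - 1) (B i)" by (simp add: inj_on_def)
      then show "n < card ((\<lambda>a. z ^ a - 1) ` B i)" using n by (simp add: card_image)
      fix r assume "r \<in> (\<lambda>a. z ^ a - 1) ` B i"
      then obtain a where a: "a \<in> B i" "r = z ^ a - 1" by blast
      have "poly g r = (\<Sum>j<m. \<Sum>b\<in>B j. of_int (H i j) * z ^ (a * b) * x j b)"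
        by (simp add: g_def poly_sum a(2) mult_ac flip: power_mult)
      then show "poly g r = 0" using ker[OF i a(1)] by simp
    qed
    then show ?thesis by (simp add: coeff_g)
  qed
  have x_mem: "x j b \<in> P" if "j < m" "b \<in> B j" "\<And>n. n < card (B j) \<Longrightarrow> F j n \<in> P" for j b
    by (rule mem_P_of_binomial_moments_P[where B = "B j"])
      (use that B xS in \<open>auto simp: F_def\<close>)
  have F_mem: "F j n \<in> P" if "j < m" "n < card (B j)" for j n
    using that
  proof (induction n arbitrary: j rule: less_induct)
    case (less n)
    \<comment> \<open>Only blocks with more than \<open>n\<close> elements matter at order
      \<open>n\<close>. For a smaller block the induction hypothesis already covers all its moments,
      so its entries, and with them every \<open>F j n\<close>, lie in \<open>P\<close>.\<close>
    define T where "T = {j. j < m \<and> n < card (B j)}"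
    have small: "F j n \<in> P" if "j < m" "j \<notin> T" for j
    proof -
      have "x j b \<in> P" if "b \<in> B j" for b
        using x_mem[OF \<open>j < m\<close> that] less.IH \<open>j < m\<close> \<open>j \<notin> T\<close> by (auto simp: T_def)
      then show ?thesis
        unfolding F_def by (subst mult.commute) (intro sum_P mult_P of_nat_mem)
    qed
    show ?case
    proof (rule principally_nonsingular_modD[OF H, of T "\<lambda>j. F j n"])
      show "T \<subseteq> {..<m}" "j \<in> T" using less.prems by (auto simp: T_def)
      show "F j n \<in> S" if "j \<in> T" for j using that FS by (simp add: T_def)
      fix i assume i: "i \<in> T"
      \<comment> \<open>Dropping the small blocks leaves exactly the principal submatrix on
        \<open>T\<close>, since the Taylor condition is available for the rows in
        \<open>T\<close>.\<close>
      have "(\<Sum>j<m. of_int (H i j) * F j n) - (\<Sum>j\<in>{..<m} - T. of_int (H i j) * F j n) \<in> P"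
        using i small by (intro diff_P taylor sum_P mult_P of_int_mem) (auto simp: T_def)
      also have "(\<Sum>j<m. of_int (H i j) * F j n) - (\<Sum>j\<in>{..<m} - T. of_int (H i j) * F j n) =
          (\<Sum>j\<in>T. of_int (H i j) * F j n)"
        by (subst sum_diff) (auto simp: T_def)
      finally show "(\<Sum>j\<in>T. of_int (H i j) * F j n) \<in> P" .
    qed
  qed
  show ?thesis using x_mem F_mem assms(8,9) by blast
qed

end

section \<open>The ring generated by a root of unity of prime order\<close>

definition int_adjoin :: "'a :: comm_ring_1 \<Rightarrow> 'a set" where
  "int_adjoin z = range (\<lambda>p. poly (of_int_poly p) z)"

lemma int_adjoinI: "x = poly (of_int_poly p) z \<Longrightarrow> x \<in> int_adjoin z"
  by (auto simp: int_adjoin_def)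

lemma unital_subring_int_adjoin: "unital_subring (int_adjoin (z :: 'a :: idom))"
proof
  show "0 \<in> int_adjoin z" by (rule int_adjoinI[of _ 0]) simp
  show "1 \<in> int_adjoin z" by (rule int_adjoinI[of _ 1]) simp
  fix x assume "x \<in> int_adjoin z"
  then obtain p where p: "x = poly (of_int_poly p) z" by (auto simp: int_adjoin_def)
  then show "- x \<in> int_adjoin z" by (intro int_adjoinI[of _ "- p"]) (simp add: hom_distribs)
  fix y assume "y \<in> int_adjoin z"
  then obtain r where r: "y = poly (of_int_poly r) z" by (auto simp: int_adjoin_def)
  show "x + y \<in> int_adjoin z" using p r by (intro int_adjoinI[of _ "p + r"]) (simp add: hom_distribs)
  show "x * y \<in> int_adjoin z" using p r by (intro int_adjoinI[of _ "p * r"]) (simp add: hom_distribs)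
qed

lemma int_adjoin_self: "z \<in> int_adjoin z"
  by (rule int_adjoinI[of _ "[:0, 1:]"]) simp

text \<open>Multiplication by \<open>x\<close> acts on the span of the powers of \<open>z\<close> by an integer matrix, of which
  \<open>x\<close> is an eigenvalue.\<close>

lemma algebraic_int_int_adjoin_root_of_unity:
  fixes z :: "'a :: field_char_0"
  assumes "z ^ n = 1" "n > 0" "x \<in> int_adjoin z"
  shows "algebraic_int x"
proof -
  \<comment> \<open>The exponent \<open>i\<close> stays arbitrary because each step of the induction
    on \<open>p\<close> raises it by one; exponents are then reduced modulo
    \<open>n\<close>.\<close>
  have "\<exists>f. poly (of_int_poly p) z * z ^ i = (\<Sum>j<n. of_int (f j) * z ^ j)" for p i
  proof (induction p arbitrary: i)
    case 0
    then show ?case by (intro exI[of _ "\<lambda>_. 0"]) simp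
  next
    case (pCons a p)
    obtain f where f: "poly (of_int_poly p) z * z ^ Suc i = (\<Sum>j<n. of_int (f j) * z ^ j)"
      using pCons.IH by blast
    have "z ^ i = z ^ (n * (i div n) + i mod n)" by simp
    also have "\<dots> = z ^ (i mod n)" unfolding power_add power_mult using assms(1) by simp
    finally have zi: "z ^ i = z ^ (i mod n)" .
    have "of_int a * z ^ i = (\<Sum>j<n. of_int (if j = i mod n then a else 0) * z ^ j)"
      using assms(2) by (subst zi) (simp add: if_distrib[of of_int] if_distrib[of "\<lambda>c. c * _"] sum.delta cong: if_cong)
    moreover have "poly (of_int_poly (pCons a p)) z * z ^ i =
        of_int a * z ^ i + poly (of_int_poly p) z * z ^ Suc i"
      using pCons.hyps by (simp add: algebra_simps)
    ultimately show ?case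
      by (intro exI[of _ "\<lambda>j. (if j = i mod n then a else 0) + f j"])
        (simp only: f of_int_add distrib_right sum.distrib)
  qed
  then have "\<exists>f. x * z ^ i = (\<Sum>j<n. of_int (f j) * z ^ j)" for i
    using assms(3) by (auto simp: int_adjoin_def)
  then obtain f where f: "\<And>i. x * z ^ i = (\<Sum>j<n. of_int (f i j) * z ^ j)" by metis
  define A where "A = mat n n (\<lambda>(i, j). f i j)"
  let ?A = "map_mat of_int A :: 'a mat" and ?v = "vec n (\<lambda>i. z ^ i)"
  have A: "A \<in> carrier_mat n n" "?A \<in> carrier_mat n n" by (auto simp: A_def)
  have "?A *\<^sub>v ?v = x \<cdot>\<^sub>v ?v"
    by (rule eq_vecI) (auto simp: A_def f scalar_prod_def atLeast0LessThan)
  \<comment> \<open>Its entry at index 0 is 1.\<close>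
  moreover have "?v \<noteq> 0\<^sub>v n"
  proof
    assume "?v = 0\<^sub>v n"
    then have "?v $ 0 = 0\<^sub>v n $ 0" by simp
    then show False using assms(2) by simp
  qed
  ultimately have "eigenvalue ?A x"
    using A unfolding eigenvalue_def eigenvector_def by (intro exI[of _ ?v]) auto
  then have "poly (of_int_poly (char_poly A)) x = 0"
    using eigenvalue_root_char_poly[OF A(2)] of_int_hom.char_poly_hom[OF A(1)] by metis
  moreover have "lead_coeff (char_poly A) = 1"
    using degree_monic_char_poly[OF A(1)] by simp
  ultimately show ?thesis unfolding algebraic_int_altdef_ipoly by blast
qed

text \<open>Since \<open>x\<close> is nonzero, factors X can be stripped from \<open>p\<close> until
  the constant term is nonzero; that term is then \<open>x\<close> times an element of
  \<open>S\<close>.\<close>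

lemma (in unital_subring) divides_nonzero_int:
  assumes "p \<noteq> 0" "poly (of_int_poly p) x = 0" "x \<in> S" "x \<noteq> 0"
  shows "\<exists>a s. a \<noteq> 0 \<and> s \<in> S \<and> of_int a = x * s"
  using assms(1,2)
proof (induction p)
  case 0
  then show ?case by simp
next
  case (pCons a p)
  have eq: "of_int a + x * poly (of_int_poly p) x = 0"
    using pCons.prems pCons.hyps by simp
  show ?case
  proof (cases "a = 0")
    case True
    then show ?thesis using pCons.IH pCons.prems eq assms(4) by auto
  next
    case False
    have "- poly (of_int_poly p) x \<in> S"
      using assms(3) by (intro uminus_mem poly_mem) (simp_all add: of_int_mem)
    moreover have "of_int a = x * (- poly (of_int_poly p) x)"
      using eq by (simp add: eq_neg_iff_add_eq_0)
    ultimately show ?thesis using False by blast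
  qed
qed

section \<open>Descent along the powers of 1 - z\<close>

locale prime_root_of_unity =
  fixes q :: nat and z :: "'a :: field_char_0"
  assumes prime_q: "prime q" and odd_q: "odd q" and z_pow: "z ^ q = 1" and z_neq: "z \<noteq> 1"
begin

abbreviation "cyc \<equiv> int_adjoin z"

abbreviation "cyc_ideal \<equiv> (*) (1 - z) ` cyc"

interpretation unital_subring cyc
  by (rule unital_subring_int_adjoin)

sublocale subring_prime_ideal cyc cyc_ideal q
proof
  have lam: "1 - z \<in> cyc" by (intro diff_mem one_mem int_adjoin_self)
  then show "cyc_ideal \<subseteq> cyc" by (auto intro: mult_mem)
  show "0 \<in> cyc_ideal" by (rule image_eqI[of _ _ 0]) auto
  show "x + y \<in> cyc_ideal" if "x \<in> cyc_ideal" "y \<in> cyc_ideal" for x y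
    using that by (auto simp: distrib_left[symmetric] intro: add_mem)
  show "x * y \<in> cyc_ideal" if "x \<in> cyc" "y \<in> cyc_ideal" for x y
    using that by (auto simp: mult.left_commute[of x] intro: mult_mem)
  \<comment> \<open>The powers of \<open>z\<close> sum to 0, so \<open>q\<close> is the sum of the
    differences \<open>1 - z ^ k\<close>, each a multiple of \<open>1 - z\<close>.\<close>
  have "(\<Sum>k<q. z ^ k) = 0"
    using power_diff_1_eq[of z q] z_pow z_neq by simp
  then have "of_nat q = (\<Sum>k<q. 1 - z ^ k)" by (simp add: sum_subtractf)
  also have "\<dots> = (\<Sum>k<q. (1 - z) * (\<Sum>i<k. z ^ i))"
    using z_neq by (intro sum.cong) (simp_all add: one_diff_power_eq)
  also have "\<dots> = (1 - z) * (\<Sum>k<q. \<Sum>i<k. z ^ i)" by (simp add: sum_distrib_left)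
  also have "\<dots> \<in> cyc_ideal"
    by (intro imageI sum_mem power_mem int_adjoin_self)
  finally show "of_nat q \<in> cyc_ideal" .
  show "prime q" by (rule prime_q)
qed

text \<open>A coincidence gives \<open>z ^ (b - a) = 1\<close> with \<open>b - a\<close> prime to
  \<open>q\<close>; together with \<open>z ^ q = 1\<close>, Bezout forces
  \<open>z = 1\<close>.\<close>

lemma inj_on_power: "inj_on (\<lambda>a. z ^ a) {..<q}"
proof (rule linorder_inj_onI')
  fix a b assume "a \<in> {..<q}" "b \<in> {..<q}" "a < b"
  show "z ^ a \<noteq> z ^ b"
  proof
    assume "z ^ a = z ^ b"
    moreover have "z ^ b = z ^ a * z ^ (b - a)"
      using \<open>a < b\<close> by (simp flip: power_add)
    moreover have "z \<noteq> 0" using z_pow prime_q by (metis power_0_left prime_gt_0_nat zero_neq_one less_irrefl)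
    ultimately have one: "z ^ (b - a) = 1" by simp
    have "\<not> q dvd b - a"
      using \<open>a < b\<close> \<open>b \<in> {..<q}\<close> by (auto dest: dvd_imp_le)
    then have "coprime (b - a) q"
      using prime_q prime_imp_coprime coprime_commute by metis
    then obtain u v where "(b - a) * u = q * v + 1"
      using bezout_nat[of "b - a" q] \<open>a < b\<close> by auto
    then have "z ^ ((b - a) * u) = z ^ (q * v + 1)" by simp
    then show False using one z_pow z_neq by (simp add: power_mult)
  qed
qed

text \<open>Turns divisibility by powers of \<open>1 - z\<close> into divisibility by powers of
  \<open>q\<close>. In the binomial expansion the two outer terms are 1 and -1, because
  \<open>q\<close> is odd and \<open>z ^ q = 1\<close>, and the inner coefficients are multiples of
  \<open>q\<close>.\<close>

lemma power_prime_eq: "\<exists>t\<in>cyc. (1 - z) ^ q = of_nat q * t"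
proof -
  have q: "q > 0" using prime_q by (simp add: prime_gt_0_nat)
  have "(1 - z) ^ q = (\<Sum>k\<le>q. of_nat (q choose k) * (- z) ^ k)"
    using binomial_ring[of "- z" 1 q] by simp
  also have "{..q} = insert 0 (insert q {1..<q})" using q by auto
  also have "(\<Sum>k\<in>insert 0 (insert q {1..<q}). of_nat (q choose k) * (- z) ^ k) =
      (\<Sum>k\<in>{1..<q}. of_nat (q choose k) * (- z) ^ k)"
    using q odd_q z_pow by simp
  also have "\<dots> = (\<Sum>k\<in>{1..<q}. of_nat q * (of_nat ((q choose k) div q) * (- z) ^ k))"
  proof (intro sum.cong refl)
    fix k assume "k \<in> {1..<q}"
    then have "q dvd q choose k" by (intro dvd_choose_prime) (use prime_q in auto)
    then have "q choose k = q * ((q choose k) div q)" by simp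
    then have "of_nat (q choose k) = (of_nat q * of_nat ((q choose k) div q) :: 'a)"
      by (metis of_nat_mult)
    then show "of_nat (q choose k) * (- z) ^ k = of_nat q * (of_nat ((q choose k) div q) * (- z) ^ k)"
      by simp
  qed
  also have "\<dots> = of_nat q * (\<Sum>k\<in>{1..<q}. of_nat ((q choose k) div q) * (- z) ^ k)"
    by (simp add: sum_distrib_left)
  finally show ?thesis
    by (rule bexI) (intro sum_mem mult_mem of_nat_mem power_mem uminus_mem int_adjoin_self)
qed

text \<open>A nonzero \<open>x\<close> divides a nonzero integer \<open>a\<close>. Then
  \<open>a\<close> is divisible by every power of \<open>q\<close> in \<open>cyc\<close>, and the
  quotient, a rational algebraic integer, is an integer.\<close>

lemma eq_0_if_all_powers_dvd:
  assumes "x \<in> cyc" "\<And>m. \<exists>s\<in>cyc. x = (1 - z) ^ m * s"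
  shows "x = 0"
proof (rule ccontr)
  assume "x \<noteq> 0"
  have q: "q > 0" "q > 1" using prime_q by (auto intro: prime_gt_0_nat prime_gt_1_nat simp del: One_nat_def)
  note integral = algebraic_int_int_adjoin_root_of_unity[OF z_pow q(1)]
  obtain p where "poly (of_int_poly p) x = 0" "lead_coeff p = 1"
    using integral[OF assms(1)] by (auto simp: algebraic_int_altdef_ipoly)
  moreover from this have "p \<noteq> 0" by auto
  ultimately obtain a s where a: "a \<noteq> 0" "s \<in> cyc" "of_int a = x * s"
    using divides_nonzero_int[of p x] assms(1) \<open>x \<noteq> 0\<close> by blast
  obtain t where t: "t \<in> cyc" "(1 - z) ^ q = of_nat q * t" using power_prime_eq by blast
  \<comment> \<open>With this exponent \<open>q ^ m\<close> exceeds the absolute value of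
    \<open>a\<close>, so it cannot divide \<open>a\<close>.\<close>
  define m where "m = nat \<bar>a\<bar>"
  obtain u where u: "u \<in> cyc" "x = (1 - z) ^ (q * m) * u" using assms(2) by blast
  define w where "w = t ^ m * u * s"
  have "of_int a = of_nat q ^ m * w"
    by (simp add: a(3) u(2) power_mult t(2) power_mult_distrib w_def)
  moreover have "w \<in> cyc" unfolding w_def using t u a by (intro mult_mem power_mem)
  ultimately have w: "algebraic_int w" "w = of_int a / of_nat (q ^ m)"
    using integral q by (auto simp: field_simps)
  then have "w \<in> \<rat>" by auto
  with w(1) have "w \<in> \<int>" by (rule rational_algebraic_int_is_int)
  then obtain k where "w = of_int k" by (auto elim: Ints_cases)
  then have "of_int a = (of_int (int (q ^ m) * k) :: 'a)"
    using w(2) q by (simp add: field_simps)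
  then have "a = int (q ^ m) * k" by (simp only: of_int_eq_iff)
  then have "int (q ^ m) \<le> \<bar>a\<bar>"
    using a(1) by (metis dvd_triv_left dvd_abs_iff zdvd_imp_le zero_less_abs_iff)
  then have "int (q ^ m) \<le> int m" by (simp add: m_def)
  then have "q ^ m \<le> m" by (simp only: of_nat_le_iff)
  moreover have "m < 2 ^ m" by (rule less_exp)
  moreover have "2 ^ m \<le> q ^ m" using q by (intro power_mono) auto
  ultimately show False by simp
qed

text \<open>The entries of \<open>v\<close> may be any field elements. Elimination replaces
  \<open>v\<close> by a nonzero kernel vector over \<open>cyc\<close>; each such vector is
  \<open>1 - z\<close> times another one, so its entries are divisible by all powers of
  \<open>1 - z\<close>.\<close>

lemma kernel_eq_0:
  assumes H: "principally_nonsingular_mod m H"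
    and B: "\<And>j. j < m \<Longrightarrow> B j \<subseteq> {..<q}"
    and ker: "\<And>i a. i < m \<Longrightarrow> a \<in> B i \<Longrightarrow>
      (\<Sum>j<m. \<Sum>b\<in>B j. of_int (H i j) * z ^ (a * b) * v j b) = 0"
    and "j < m" "b \<in> B j"
  shows "v j b = 0"
proof (rule ccontr)
  assume "v j b \<noteq> 0"
  define C where "C = Sigma {..<m} B"
  define A where "A = (\<lambda>(i, a) (j, b). of_int (H i j) * z ^ (a * b))"
  have fin: "finite (B j)" if "j < m" for j
    using B[OF that] finite_subset by blast
  have sum_C: "(\<Sum>c\<in>C. A (i, a) c * w c) =
      (\<Sum>j<m. \<Sum>b\<in>B j. of_int (H i j) * z ^ (a * b) * w (j, b))" for i a w
    unfolding C_def A_def by (subst sum.Sigma) (auto simp: fin intro!: sum.cong)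
  define is_ker where "is_ker w \<longleftrightarrow>
    (\<forall>c\<in>C. w c \<in> cyc) \<and> (\<forall>r\<in>C. (\<Sum>c\<in>C. A r c * w c) = 0)" for w
  have "\<exists>w. (\<forall>c\<in>C. w c \<in> cyc) \<and> (\<exists>c\<in>C. w c \<noteq> 0) \<and> (\<forall>r\<in>C. (\<Sum>c\<in>C. A r c * w c) = 0)"
  proof (rule linear_system_solution_mem[where v = "\<lambda>(j, b). v j b"])
    show "finite C" by (auto simp: C_def fin)
    show "A r c \<in> cyc" for r c
      by (cases r; cases c) (auto simp: A_def intro!: mult_mem of_int_mem power_mem int_adjoin_self)
    show "(\<Sum>c\<in>C. A r c * (case c of (j, b) \<Rightarrow> v j b)) = 0" if "r \<in> C" for r
      using that ker by (cases r) (simp add: sum_C, auto simp: C_def)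
    show "\<exists>c\<in>C. (case c of (j, b) \<Rightarrow> v j b) \<noteq> 0"
      using assms(4,5) \<open>v j b \<noteq> 0\<close> by (intro bexI[of _ "(j, b)"]) (auto simp: C_def)
  qed
  then obtain w where w: "is_ker w" "\<exists>c\<in>C. w c \<noteq> 0" unfolding is_ker_def by blast
  have step: "\<exists>u. is_ker u \<and> (\<forall>c\<in>C. w c = (1 - z) * u c)" if "is_ker w" for w
  proof -
    have "w (j, b) \<in> cyc_ideal" if "j < m" "b \<in> B j" for j b
    proof (rule kernel_mem_P[OF H, where z = z and B = B and x = "\<lambda>j b. w (j, b)"])
      show "1 - z \<in> cyc_ideal" by (rule image_eqI[of _ _ 1]) auto
      show "(\<Sum>j<m. \<Sum>b\<in>B j. of_int (H i j) * z ^ (a * b) * w (j, b)) = 0"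
        if "i < m" "a \<in> B i" for i a
        using \<open>is_ker w\<close> that unfolding is_ker_def sum_C[symmetric] by (auto simp: C_def)
    qed (use that \<open>is_ker w\<close> B in \<open>auto simp: is_ker_def C_def inj_on_power int_adjoin_self\<close>)
    then have "\<forall>c\<in>C. \<exists>s\<in>cyc. w c = (1 - z) * s" by (auto simp: C_def)
    then obtain u where u: "\<And>c. c \<in> C \<Longrightarrow> u c \<in> cyc \<and> w c = (1 - z) * u c" by metis
    have "(\<Sum>c\<in>C. A r c * u c) = 0" if "r \<in> C" for r
    proof -
      have "(1 - z) * (\<Sum>c\<in>C. A r c * u c) = (\<Sum>c\<in>C. A r c * w c)"
        unfolding sum_distrib_left using u by (intro sum.cong) (simp_all add: mult.left_commute)
      also have "\<dots> = 0" using \<open>is_ker w\<close> that by (simp add: is_ker_def)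
      finally show ?thesis using z_neq by simp
    qed
    then show ?thesis using u unfolding is_ker_def by blast
  qed
  have pow: "\<exists>u. is_ker u \<and> (\<forall>c\<in>C. w c = (1 - z) ^ n * u c)" for n
  proof (induction n)
    case 0
    then show ?case using w by auto
  next
    case (Suc n)
    then obtain u where u: "is_ker u" "\<forall>c\<in>C. w c = (1 - z) ^ n * u c" by blast
    with step[of u] obtain u' where "is_ker u'" "\<forall>c\<in>C. u c = (1 - z) * u' c" by blast
    with u(2) show ?case by (intro exI[of _ u']) (simp add: mult.assoc mult.left_commute)
  qed
  have "w c = 0" if "c \<in> C" for c
  proof (rule eq_0_if_all_powers_dvd)
    show "w c \<in> cyc" using w that by (simp add: is_ker_def)
    show "\<exists>s\<in>cyc. w c = (1 - z) ^ n * s" for n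
      using pow[of n] that by (auto simp: is_ker_def)
  qed
  with w(2) show False by blast
qed

end

section \<open>From principal minors to kernel vectors\<close>

lemma sum_mult_blocks:
  fixes f :: "nat \<Rightarrow> 'a :: comm_monoid_add"
  assumes "I \<subseteq> {..<m * q}" "q > 0"
  shows "(\<Sum>c\<in>I. f c) = (\<Sum>j<m. \<Sum>b\<in>{b. b < q \<and> j * q + b \<in> I}. f (j * q + b))"
proof -
  have "(\<Sum>j<m. \<Sum>b\<in>{b. b < q \<and> j * q + b \<in> I}. f (j * q + b)) =
      (\<Sum>(j, b)\<in>Sigma {..<m} (\<lambda>j. {b. b < q \<and> j * q + b \<in> I}). f (j * q + b))"
    by (subst sum.Sigma) auto
  also have "\<dots> = (\<Sum>c\<in>I. f c)"
    using assms
    by (intro sum.reindex_bij_witness[of _ "\<lambda>c. (c div q, c mod q)" "\<lambda>(j, b). j * q + b"])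
      (auto simp: less_mult_imp_div_less)
  finally show ?thesis by simp
qed

text \<open>Lets kernel vectors be handled as functions on \<open>I\<close> itself instead of on
  positions in the submatrix.\<close>

lemma det_submatrix_neq_0:
  fixes A :: "'a :: idom mat"
  assumes A: "A \<in> carrier_mat n n" and I: "I \<subseteq> {..<n}"
    and inj: "\<And>x. (\<And>r. r \<in> I \<Longrightarrow> (\<Sum>c\<in>I. A $$ (r, c) * x c) = 0) \<Longrightarrow> \<forall>c\<in>I. x c = 0"
  shows "det (submatrix A I I) \<noteq> 0"
proof
  assume det: "det (submatrix A I I) = 0"
  have fin: "finite I" using I finite_subset by blast
  have I_eq: "{i. i < n \<and> i \<in> I} = I" using I by auto
  \<comment> \<open>The rank of \<open>c\<close> within \<open>I\<close>, inverse to the increasing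
    enumeration \<open>pick I\<close>.\<close>
  define idx where "idx c = card {a \<in> I. a < c}" for c
  have idx: "idx c < card I" "pick I (idx c) = c" if "c \<in> I" for c
    using that fin by (auto simp: idx_def pick_card_in_set intro!: psubset_card_mono)
  have pick: "pick I k \<in> I" "idx (pick I k) = k" if "k < card I" for k
    using that by (auto simp: idx_def pick_in_set_le card_pick)
  have sub: "submatrix A I I \<in> carrier_mat (card I) (card I)"
    using A by (intro carrier_matI) (simp_all add: dim_submatrix I_eq)
  obtain v where v: "v \<in> carrier_vec (card I)" "v \<noteq> 0\<^sub>v (card I)"
      "submatrix A I I *\<^sub>v v = 0\<^sub>v (card I)"
    using det det_0_iff_vec_prod_zero[OF sub] by blast
  have "(\<Sum>c\<in>I. A $$ (r, c) * v $ idx c) = 0" if r: "r \<in> I" for r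
  proof -
    have "0 = (submatrix A I I *\<^sub>v v) $ idx r"
      using v(3) idx(1)[OF r] by simp
    also have "\<dots> = (\<Sum>k<card I. submatrix A I I $$ (idx r, k) * v $ k)"
      using idx(1)[OF r] v(1) sub by (auto simp: scalar_prod_def atLeast0LessThan)
    also have "\<dots> = (\<Sum>k<card I. A $$ (r, pick I k) * v $ k)"
      using A idx[OF r] by (intro sum.cong) (auto simp: submatrix_index I_eq)
    also have "\<dots> = (\<Sum>c\<in>I. A $$ (r, c) * v $ idx c)"
      by (rule sum.reindex_bij_witness[of _ idx "pick I"]) (auto simp: pick idx)
    finally show ?thesis by simp
  qed
  then have "v $ idx c = 0" if "c \<in> I" for c
    using inj[of "\<lambda>c. v $ idx c"] that by blast
  then have "v $ k = 0" if "k < card I" for k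
    using pick[OF that] by metis
  then have "v = 0\<^sub>v (card I)" using v(1) by (intro eq_vecI) auto
  with v(2) show False by blast
qed

text \<open>Cutting \<open>I\<close> into its intersections with the blocks of length
  \<open>q\<close> gives the sets \<open>?B j\<close>. The minor being principal, rows and columns
  have the same sets, as \<open>kernel_eq_0\<close> requires.\<close>

lemma (in prime_root_of_unity) principally_nonsingular_blocks:
  assumes A: "A \<in> carrier_mat (m * q) (m * q)"
    and entry: "\<And>r c. r < m * q \<Longrightarrow> c < m * q \<Longrightarrow>
      A $$ (r, c) = of_int (H (r div q) (c div q)) * z ^ ((r mod q) * (c mod q))"
    and H: "principally_nonsingular_mod m H"
  shows "principally_nonsingular A"
  unfolding principally_nonsingular_def
proof (intro conjI allI impI)
  show "square_mat A" using A by auto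
  fix I assume "I \<subseteq> {..<dim_row A}"
  then have I: "I \<subseteq> {..<m * q}" using A by auto
  have q: "q > 0" using prime_q by (simp add: prime_gt_0_nat)
  let ?B = "\<lambda>j. {b. b < q \<and> j * q + b \<in> I}"
  show "det (submatrix A I I) \<noteq> 0"
  proof (rule det_submatrix_neq_0[OF A I], intro ballI)
    fix x c
    assume ker: "\<And>r. r \<in> I \<Longrightarrow> (\<Sum>c\<in>I. A $$ (r, c) * x c) = 0" and c: "c \<in> I"
    have "x ((c div q) * q + c mod q) = 0"
    proof (rule kernel_eq_0[OF H, where B = ?B and v = "\<lambda>j b. x (j * q + b)"])
      fix i a assume "i < m" "a \<in> ?B i"
      then have a: "a < q" "i * q + a \<in> I" by auto
      have "0 = (\<Sum>j<m. \<Sum>b\<in>?B j. A $$ (i * q + a, j * q + b) * x (j * q + b))"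
        using ker[OF a(2)] by (simp add: sum_mult_blocks[OF I q])
      also have "\<dots> = (\<Sum>j<m. \<Sum>b\<in>?B j. of_int (H i j) * z ^ (a * b) * x (j * q + b))"
        using a I by (intro sum.cong refl) (auto simp: entry subset_iff)
      finally show "(\<Sum>j<m. \<Sum>b\<in>?B j. of_int (H i j) * z ^ (a * b) * x (j * q + b)) = 0" by simp
    qed (use I c q in \<open>auto simp: less_mult_imp_div_less\<close>)
    then show "x c = 0" by simp
  qed
qed

section \<open>The Sylvester matrices\<close>

text \<open>All pivots met in the recursive computation of the principal minors divide \<open>d\<close>; since the Schur
  complements are not divided by the pivot, these are not the minors themselves.\<close>

function schur_pivots_dvd :: "int \<Rightarrow> int list list \<Rightarrow> bool" where
  "schur_pivots_dvd d [] = True"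
| "schur_pivots_dvd d ([] # rs) = False"
| "schur_pivots_dvd d ((a # r) # rs) =
    (a dvd d \<and> schur_pivots_dvd d (map tl rs) \<and>
     schur_pivots_dvd d (map (\<lambda>s. map2 (\<lambda>y x. a * y - hd s * x) (tl s) r) rs))"
  by pat_completeness auto
termination by (relation "measure (\<lambda>(_, rs). length rs)") auto

text \<open>A pivot dividing \<open>d\<close> is prime to \<open>q\<close> because \<open>d\<close>
  is. The two recursive calls supply the two smaller matrices of
  \<open>principally_nonsingular_mod_Suc\<close>.\<close>

lemma (in subring_prime_ideal) principally_nonsingular_mod_if_schur_pivots_dvd:
  assumes "schur_pivots_dvd d rs" "\<not> int q dvd d" "length rs = m" "\<forall>r\<in>set rs. length r = m"
  shows "principally_nonsingular_mod m (\<lambda>i j. rs ! i ! j)"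
  using assms
proof (induction d rs arbitrary: m rule: schur_pivots_dvd.induct)
  case (1 d)
  then show ?case by (simp add: principally_nonsingular_mod_0)
next
  case (2 d rs)
  then show ?case by simp
next
  case (3 d a r rs)
  then obtain n where m: "m = Suc n" "length rs = n" "length r = n" by auto
  have len: "length (rs ! i) = Suc n" if "i < n" for i
    using 3 m that by auto
  have "principally_nonsingular_mod n (\<lambda>i j. map tl rs ! i ! j)"
    by (rule "3.IH"(1)) (use 3 m in auto)
  then have rest: "principally_nonsingular_mod n (\<lambda>i j. ((a # r) # rs) ! Suc i ! Suc j)"
    by (rule principally_nonsingular_mod_cong[THEN iffD1, rotated]) (use m len in \<open>auto simp: nth_tl\<close>)
  have "principally_nonsingular_mod n
      (\<lambda>i j. map (\<lambda>s. map2 (\<lambda>y x. a * y - hd s * x) (tl s) r) rs ! i ! j)"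
    by (rule "3.IH"(2)) (use 3 m in auto)
  then have schur: "principally_nonsingular_mod n (\<lambda>i j. ((a # r) # rs) ! 0 ! 0 * ((a # r) # rs) ! Suc i ! Suc j
      - ((a # r) # rs) ! Suc i ! 0 * ((a # r) # rs) ! 0 ! Suc j)"
  proof (rule principally_nonsingular_mod_cong[THEN iffD1, rotated])
    fix i j assume "i < n" "j < n"
    moreover from this have "hd (rs ! i) = rs ! i ! 0" using len[of i] by (intro hd_conv_nth) auto
    ultimately show "map (\<lambda>s. map2 (\<lambda>y x. a * y - hd s * x) (tl s) r) rs ! i ! j =
        ((a # r) # rs) ! 0 ! 0 * ((a # r) # rs) ! Suc i ! Suc j
        - ((a # r) # rs) ! Suc i ! 0 * ((a # r) # rs) ! 0 ! Suc j"
      using m len[of i] by (simp add: nth_tl)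
  qed
  have "\<not> int q dvd a" using "3.prems" dvd_trans by auto
  then show ?case
    unfolding m(1) by (intro principally_nonsingular_mod_Suc rest schur) simp
qed

text \<open>An integer model of the Kronecker powers of \<open>fourier_mat 2\<close>, executable so
  that the certificates can be evaluated.\<close>

primrec sylvester :: "nat \<Rightarrow> nat \<Rightarrow> nat \<Rightarrow> int" where
  "sylvester 0 i j = 1"
| "sylvester (Suc k) i j =
    (if i div 2 ^ k = 1 \<and> j div 2 ^ k = 1 then - 1 else 1) * sylvester k (i mod 2 ^ k) (j mod 2 ^ k)"

lemma kronecker_power_fourier_2:
  shows "dim_row (kronecker_power (fourier_mat 2) k) = 2 ^ k"
    and "dim_col (kronecker_power (fourier_mat 2) k) = 2 ^ k"
  by (induction k) (simp_all add: kronecker_mat_def fourier_mat_def)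

lemma kronecker_power_fourier_2_index:
  assumes "i < 2 ^ k" "j < 2 ^ k"
  shows "kronecker_power (fourier_mat 2) k $$ (i, j) = of_int (sylvester k i j)"
  using assms
proof (induction k arbitrary: i j)
  case 0
  then show ?case by simp
next
  case (Suc k)
  have F: "fourier_mat 2 $$ (a, b) = (if a = 1 \<and> b = 1 then - 1 else 1)" if "a < 2" "b < 2" for a b
    using that by (auto simp: fourier_mat_def less_2_cases_iff)
  have less: "i div 2 ^ k < 2" "j div 2 ^ k < 2"
    using Suc.prems by (simp_all add: less_mult_imp_div_less)
  have dims: "dim_row (fourier_mat 2) = 2" "dim_col (fourier_mat 2) = 2"
    by (simp_all add: fourier_mat_def)
  show ?case
    using Suc.prems F[OF less] Suc.IH[of "i mod 2 ^ k" "j mod 2 ^ k"]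
    by (simp add: kronecker_mat_def dims kronecker_power_fourier_2)
qed

section \<open>Complex Fourier matrices with permuted columns\<close>

lemma prime_root_of_unity_exp:
  assumes "prime q" "odd q"
  shows "prime_root_of_unity q (exp (2 * of_real pi * \<i> / of_nat q))"
proof
  have q: "q > 2" using assms prime_ge_2_nat[of q] by (cases "q = 2") auto
  show "exp (2 * of_real pi * \<i> / of_nat q) ^ q = 1"
    using q by (simp flip: exp_of_nat_mult)
  show "exp (2 * of_real pi * \<i> / of_nat q) \<noteq> 1"
  proof
    assume "exp (2 * of_real pi * \<i> / of_nat q) = 1"
    then have "Re (exp (2 * of_real pi * \<i> / of_nat q)) = 1" by simp
    then have "cos (2 * pi / q) = 1" by (simp add: Re_exp)
    \<comment> \<open>The angle lies strictly between 0 and pi because \<open>q > 2\<close>, and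
      cosine is strictly decreasing there.\<close>
    moreover have "cos (2 * pi / q) < cos 0"
      using q by (intro cos_monotone_0_pi) (auto simp: field_simps)
    ultimately show False by simp
  qed
qed (use assms in auto)

text \<open>The map \<open>\<sigma>\<close> moves whole blocks of \<open>q\<close> columns, so the
  result is still a Kronecker product with \<open>fourier_mat q\<close>, the first factor being a
  Sylvester matrix with reordered columns.\<close>

lemma principally_nonsingular_permuted_columns:
  assumes q: "prime q" "odd q" and A: "A \<in> carrier_mat (2 ^ k * q) (2 ^ k * q)"
    and entry: "\<And>r c. r < 2 ^ k * q \<Longrightarrow> c < 2 ^ k * q \<Longrightarrow>
      A $$ (r, c) = kronecker_mat (kronecker_power (fourier_mat 2) k) (fourier_mat q) $$
        (r, \<sigma> (c div q) * q + c mod q)"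
    and \<sigma>: "\<And>j. j < 2 ^ k \<Longrightarrow> \<sigma> j < 2 ^ k"
    and cert: "schur_pivots_dvd (2 ^ e) (map (\<lambda>i. map (\<lambda>j. sylvester k i (\<sigma> j)) [0..<2 ^ k]) [0..<2 ^ k])"
  shows "principally_nonsingular A"
proof -
  define z :: complex where "z = exp (2 * of_real pi * \<i> / of_nat q)"
  interpret prime_root_of_unity q z
    unfolding z_def using q by (rule prime_root_of_unity_exp)
  have q0: "q > 0" using q by (simp add: prime_gt_0_nat)
  show ?thesis
  proof (rule principally_nonsingular_blocks[OF A])
    have "\<not> q dvd 2 ^ e"
      using q primes_dvd_imp_eq[of q 2] prime_dvd_power[of q 2 e] by (metis even_numeral two_is_prime_nat)
    then have "\<not> int q dvd 2 ^ e"
      by (metis of_nat_dvd_iff of_nat_numeral of_nat_power)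
    from principally_nonsingular_mod_if_schur_pivots_dvd[OF cert this, of "2 ^ k"]
    have "principally_nonsingular_mod (2 ^ k)
        (\<lambda>i j. map (\<lambda>i. map (\<lambda>j. sylvester k i (\<sigma> j)) [0..<2 ^ k]) [0..<2 ^ k] ! i ! j)"
      by auto
    then show "principally_nonsingular_mod (2 ^ k) (\<lambda>i j. sylvester k i (\<sigma> j))"
      by (rule principally_nonsingular_mod_cong[THEN iffD1, rotated]) simp
    fix r c assume rc: "r < 2 ^ k * q" "c < 2 ^ k * q"
    then have less: "r div q < 2 ^ k" "c div q < 2 ^ k" by (auto simp: less_mult_imp_div_less)
    have dims: "dim_row (fourier_mat q) = q" "dim_col (fourier_mat q) = q"
      by (simp_all add: fourier_mat_def)
    have "A $$ (r, c) = kronecker_mat (kronecker_power (fourier_mat 2) k) (fourier_mat q) $$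
        (r div q * q + r mod q, \<sigma> (c div q) * q + c mod q)"
      using entry[OF rc] by simp
    also have "\<dots> = kronecker_power (fourier_mat 2) k $$ (r div q, \<sigma> (c div q)) *
        fourier_mat q $$ (r mod q, c mod q)"
      using kronecker_mat_index[of "r div q" "kronecker_power (fourier_mat 2) k" "r mod q"
          "fourier_mat q" "\<sigma> (c div q)" "c mod q"] less \<sigma> q0
      by (simp add: dims kronecker_power_fourier_2)
    also have "\<dots> = of_int (sylvester k (r div q) (\<sigma> (c div q))) * z ^ (r mod q * (c mod q))"
      using kronecker_power_fourier_2_index[OF less(1) \<sigma>[OF less(2)]] q0
      by (simp only:) (simp add: fourier_mat_def z_def)
    finally show "A $$ (r, c) = of_int (sylvester k (r div q) (\<sigma> (c div q))) * z ^ (r mod q * (c mod q))" .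
  qed
qed

lemma permutes_blocks:
  fixes m q :: nat
  assumes \<sigma>: "\<sigma> permutes {..<m}"
  shows "(\<lambda>c. if c < m * q then \<sigma> (c div q) * q + c mod q else c) permutes {..<m * q}"
    (is "?p permutes _")
proof (rule bij_imp_permutes)
  have \<sigma>_less: "\<sigma> j < m" if "j < m" for j
    using permutes_in_image[OF \<sigma>, of j] that by simp
  have less: "j * q + b < m * q" if "j < m" "b < q" for j b
  proof -
    have "j * q + b < Suc j * q" using that by simp
    also have "\<dots> \<le> m * q" using that by (intro mult_le_mono1) simp
    finally show ?thesis .
  qed
  have "?p ` {..<m * q} \<subseteq> {..<m * q}"
  proof (rule image_subsetI)
    fix c assume "c \<in> {..<m * q}"
    then have c: "c < m * q" by simp
    then have "q > 0" by (cases q) auto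
    with c have "\<sigma> (c div q) * q + c mod q < m * q"
      by (intro less \<sigma>_less less_mult_imp_div_less mod_less_divisor)
    with c show "?p c \<in> {..<m * q}" by simp
  qed
  moreover have "inj_on ?p {..<m * q}"
  proof (rule inj_onI)
    fix c d assume cd: "c \<in> {..<m * q}" "d \<in> {..<m * q}" "?p c = ?p d"
    then have q: "q > 0" by (cases q) auto
    have "(\<sigma> (c div q) * q + c mod q) div q = (\<sigma> (d div q) * q + d mod q) div q"
      "(\<sigma> (c div q) * q + c mod q) mod q = (\<sigma> (d div q) * q + d mod q) mod q"
      using cd by simp_all
    then have "\<sigma> (c div q) = \<sigma> (d div q)" "c mod q = d mod q" using q by simp_all
    \<comment> \<open>Equal images agree in block and in position within the block; the block is
      recovered because \<open>\<sigma>\<close> is injective.\<close>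
    then have "c div q = d div q" using permutes_inj[OF \<sigma>] by (auto dest: injD)
    with \<open>c mod q = d mod q\<close> show "c = d" by (metis div_mult_mod_eq)
  qed
  ultimately show "bij_betw ?p {..<m * q} {..<m * q}"
    unfolding bij_betw_def by (intro conjI endo_inj_surj finite_lessThan)
qed simp

lemma permutes_nth:
  fixes xs :: "nat list"
  assumes "distinct xs" "set xs = {..<length xs}"
  shows "(\<lambda>j. if j < length xs then xs ! j else j) permutes {..<length xs}"
proof (rule bij_imp_permutes)
  have "bij_betw ((!) xs) {..<length xs} {..<length xs}"
    using bij_betw_nth[OF assms(1) refl refl] unfolding assms(2) .
  then show "bij_betw (\<lambda>j. if j < length xs then xs ! j else j) {..<length xs} {..<length xs}"
    by (rule bij_betw_cong[THEN iffD1, rotated]) simp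
qed simp

text \<open>The list \<open>xs\<close> is the column order in one-line notation. For a literal list
  the certificate can be evaluated; the prime \<open>q\<close> does not occur in it.\<close>

lemma principally_nonsingular_upon_permutation_of_certificate:
  assumes q: "prime q" "odd q"
    and xs: "distinct xs" "set xs = {..<length xs}" "length xs = 2 ^ k"
    and cert: "schur_pivots_dvd (2 ^ e) (map (\<lambda>i. map (sylvester k i) xs) [0..<2 ^ k])"
  shows "principally_nonsingular_upon_permutation
    (kronecker_mat (kronecker_power (fourier_mat 2) k) (fourier_mat q))"
proof -
  define \<sigma> where "\<sigma> j = (if j < length xs then xs ! j else j)" for j
  have \<sigma>: "\<sigma> permutes {..<2 ^ k}"
    using permutes_nth[OF xs(1,2)] unfolding \<sigma>_def xs(3) .
  define p where "p c = (if c < 2 ^ k * q then \<sigma> (c div q) * q + c mod q else c)" for c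
  have p: "p permutes {..<2 ^ k * q}"
    unfolding p_def by (rule permutes_blocks[OF \<sigma>])
  let ?K = "kronecker_mat (kronecker_power (fourier_mat 2) k) (fourier_mat q)"
  have K: "dim_row ?K = 2 ^ k * q" "dim_col ?K = 2 ^ k * q"
    by (simp_all add: kronecker_mat_def kronecker_power_fourier_2) (simp_all add: fourier_mat_def)
  have "map (\<lambda>j. sylvester k i (\<sigma> j)) [0..<2 ^ k] = map (sylvester k i) xs" for i
    using xs(3) by (intro nth_equalityI) (simp_all add: \<sigma>_def)
  then have "schur_pivots_dvd (2 ^ e) (map (\<lambda>i. map (\<lambda>j. sylvester k i (\<sigma> j)) [0..<2 ^ k]) [0..<2 ^ k])"
    using cert by simp
  then have "principally_nonsingular (?K * permutation_mat (dim_col ?K) p)"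
  proof (rule principally_nonsingular_permuted_columns[OF q, rotated -1])
    show "?K * permutation_mat (dim_col ?K) p \<in> carrier_mat (2 ^ k * q) (2 ^ k * q)"
      by (intro carrier_matI) (simp_all only: index_mult_mat K permutation_mat_def dim_row_mat dim_col_mat)
    show "\<sigma> j < 2 ^ k" if "j < 2 ^ k" for j
      using permutes_in_image[OF \<sigma>, of j] that by simp
    fix r c assume "r < 2 ^ k * q" "c < 2 ^ k * q"
    then show "(?K * permutation_mat (dim_col ?K) p) $$ (r, c) = ?K $$ (r, \<sigma> (c div q) * q + c mod q)"
      using p by (subst mult_permutation_mat_index) (simp_all only: K, simp_all add: p_def)
  qed
  then show ?thesis
    using p K unfolding principally_nonsingular_upon_permutation_def by auto
qed

theorem corollary2:
  fixes q :: nat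
  assumes "prime q" and "odd q"
  shows "(\<forall>k \<in> {1, 2, 3 :: nat}.
            principally_nonsingular_upon_permutation
              (kronecker_mat (kronecker_power (fourier_mat 2) k) (fourier_mat q))) \<and>
         principally_nonsingular (kronecker_mat (fourier_mat 2) (fourier_mat q))"
proof -
  note cert = principally_nonsingular_upon_permutation_of_certificate[OF assms]
  \<comment> \<open>The column orders were found by exhaustive search; \<open>2 ^ e\<close> is the largest pivot.\<close>
  have "principally_nonsingular_upon_permutation (kronecker_mat (kronecker_power (fourier_mat 2) 1) (fourier_mat q))"
    by (rule cert[where xs = "[0, 1]" and e = 1]) (simp, force simp: lessThan_Suc, simp, code_simp)
  moreover have "principally_nonsingular_upon_permutation (kronecker_mat (kronecker_power (fourier_mat 2) 2) (fourier_mat q))"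
    by (rule cert[where xs = "[0, 1, 3, 2]" and e = 5]) (simp, force simp: lessThan_Suc, simp, code_simp)
  moreover have "principally_nonsingular_upon_permutation (kronecker_mat (kronecker_power (fourier_mat 2) 3) (fourier_mat q))"
    by (rule cert[where xs = "[0, 1, 3, 6, 7, 4, 5, 2]" and e = 77]) (simp, force simp: lessThan_Suc, simp, code_simp)
  \<comment> \<open>The case without permutation applies the block criterion with
    \<open>\<sigma> = id\<close> directly, so no permutation matrix has to be removed.\<close>
  moreover have "principally_nonsingular (kronecker_mat (kronecker_power (fourier_mat 2) 1) (fourier_mat q))"
  proof (rule principally_nonsingular_permuted_columns[OF assms, where \<sigma> = id and e = 1])
    show "schur_pivots_dvd (2 ^ 1) (map (\<lambda>i. map (\<lambda>j. sylvester 1 i (id j)) [0..<2 ^ 1]) [0..<2 ^ 1])"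
      by code_simp
  qed (auto simp: kronecker_mat_def kronecker_power_fourier_2 fourier_mat_def)
  ultimately show ?thesis by (simp only: ball_simps kronecker_power_one simp_thms)
qed

end
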